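(* Let $X \neq \{0\}$ be a real linear space and let $Y$ be a real Banach space. Suppose that for every closed convex normal cone $K \subset Y$ and every $K$-convex function $F : X \to Y$, the directional derivative $F'(0;h)$ exists for every $h \in X$, $h\neq 0$. Then $Y$ has no subspace isomorphic to $c_0$.
   Context: A nonempty subset $K$ of a real normed space $Y$ is a cone if $\lambda K \subset K$ for every $\lambda \ge 0$ and $K+K\subset K$. Write $x \le_K y$ if $y-x\in K$. A cone $K$ is normal if there is $C>0$ such that $0\le_K x\le_K y$ implies $\|x\|\le C\|y\|$. A function $F:X\to Y$ is $K$-convex if $\lambda F(x)+(1-\lambda)F(y)-F(\lambda x+(1-\lambda)y)\in K$ for all $x,y\in X$ and all $\lambda\in[0,1]$. The directional derivative of $F$ at $x_0\in X$ in the direction $h\neq 0$ is $F'(x_0;h)=\lim_{t\downarrow 0}\frac{F(x_0+th)-F(x_0)}{t}$, the limit being taken in the norm of $Y$; it is said to exist if this limit exists in $Y$. $c_0$ is the Banach space of real sequences converging to $0$ with the supremum norm. "Isomorphic" means linearly homeomorphic. *)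

theory Defs
  imports "HOL-Analysis.Analysis"
begin

text \<open>The library predicate \<open>cone\<close> only asks for stability under nonnegative scaling; the
  cones considered here are moreover nonempty and stable under addition.\<close>

definition order_cone :: "'a::real_vector set \<Rightarrow> bool" where
  "order_cone K \<longleftrightarrow> K \<noteq> {} \<and> cone K \<and> (\<forall>x\<in>K. \<forall>y\<in>K. x + y \<in> K)"

definition cone_le :: "'a::real_vector set \<Rightarrow> 'a \<Rightarrow> 'a \<Rightarrow> bool" where
  "cone_le K x y \<longleftrightarrow> y - x \<in> K"

definition normal_cone :: "'a::real_normed_vector set \<Rightarrow> bool" where
  "normal_cone K \<longleftrightarrow> order_cone K \<and>
     (\<exists>C>0. \<forall>x y. cone_le K 0 x \<and> cone_le K x y \<longrightarrow> norm x \<le> C * norm y)"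

definition cone_convex :: "'b::real_vector set \<Rightarrow> ('a::real_vector \<Rightarrow> 'b) \<Rightarrow> bool" where
  "cone_convex K F \<longleftrightarrow> (\<forall>x y. \<forall>l\<in>{0..1::real}.
     l *\<^sub>R F x + (1 - l) *\<^sub>R F y - F (l *\<^sub>R x + (1 - l) *\<^sub>R y) \<in> K)"

definition has_dir_derivative ::
    "('a::real_vector \<Rightarrow> 'b::real_normed_vector) \<Rightarrow> 'b \<Rightarrow> 'a \<Rightarrow> 'a \<Rightarrow> bool" where
  "has_dir_derivative F D x0 h \<longleftrightarrow>
     ((\<lambda>t::real. (F (x0 + t *\<^sub>R h) - F x0) /\<^sub>R t) \<longlongrightarrow> D) (at_right 0)"

definition dir_differentiable ::
    "('a::real_vector \<Rightarrow> 'b::real_normed_vector) \<Rightarrow> 'a \<Rightarrow> 'a \<Rightarrow> bool" where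
  "dir_differentiable F x0 h \<longleftrightarrow> (\<exists>D. has_dir_derivative F D x0 h)"

text \<open>Since \<open>nat\<close> carries the discrete topology, \<open>nat \<Rightarrow>\<^sub>C real\<close> is the space of all bounded real
  sequences with the supremum norm, and the Banach space of null sequences is the following
  subspace of it, with the induced norm.\<close>

definition c0 :: "(nat \<Rightarrow>\<^sub>C real) set" where
  "c0 = {f. apply_bcontfun f \<longlonglongrightarrow> 0}"

text \<open>The map \<open>f\<close> is only constrained on the subspace \<open>S\<close>, so its linearity is stated relative
  to \<open>S\<close> rather than by \<open>linear f\<close>.\<close>

definition linearly_homeomorphic ::
    "'a::real_normed_vector set \<Rightarrow> 'b::real_normed_vector set \<Rightarrow> bool" where
  "linearly_homeomorphic S T \<longleftrightarrow> (\<exists>f g. homeomorphism S T f g \<and>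
     (\<forall>x\<in>S. \<forall>y\<in>S. f (x + y) = f x + f y) \<and> (\<forall>c. \<forall>x\<in>S. f (c *\<^sub>R x) = c *\<^sub>R f x))"

end

theory Submission
  imports Defs
begin

text \<open>The space \<open>c\<close> of convergent sequences is isomorphic to \<open>c0\<close>: a sequence with limit \<open>a 0\<close> and
  entries \<open>a 0 + a (Suc n)\<close> is coded by the null sequence \<open>a\<close>.  The pointwise order of \<open>c\<close> gives a
  normal cone whose order does not force monotone order-bounded sequences to converge, and
  \<open>t \<mapsto> (max 0 (t - 1/(n+1)))\<^sub>n\<close> is convex into \<open>c\<close> for it.  Its difference quotients at \<open>0\<close>
  have limit entry \<open>1\<close> but tend to \<open>0\<close> at every finite entry, so they do not converge in norm.
  Transporting the cone to the copy of \<open>c0\<close> in \<open>Y\<close> and composing with a linear functional on \<open>X\<close>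
  contradicts the hypothesis.\<close>

section \<open>Linear embeddings of a subspace\<close>

text \<open>Rescaling a nonzero \<open>x\<close> to norm \<open>d / 2\<close> moves it to where
  continuity at \<open>0\<close> bounds \<open>f\<close> by \<open>1\<close>; undoing the scaling
  gives the constant \<open>2 / d\<close>. It serves both a homeomorphism and its inverse.\<close>

lemma homogeneous_continuous_on_subspace_bounded:
  fixes f :: "'a::real_normed_vector \<Rightarrow> 'b::real_normed_vector"
  assumes "subspace T" and cont: "continuous_on T f"
    and scale: "\<And>c x. x \<in> T \<Longrightarrow> f (c *\<^sub>R x) = c *\<^sub>R f x"
  obtains B where "B > 0" and "\<And>x. x \<in> T \<Longrightarrow> norm (f x) \<le> B * norm x"
proof -
  have "0 \<in> T"
    using \<open>subspace T\<close> by (rule subspace_0)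
  then have f0: "f 0 = 0"
    using scale[of 0 0] by simp
  obtain d where "d > 0" and d: "\<And>x. x \<in> T \<Longrightarrow> norm x < d \<Longrightarrow> norm (f x) < 1"
    using cont \<open>0 \<in> T\<close> f0 unfolding continuous_on_iff
    by (metis dist_0_norm dist_commute zero_less_one)
  show thesis
  proof
    show "2 / d > 0"
      using \<open>d > 0\<close> by simp
    fix x assume "x \<in> T"
    show "norm (f x) \<le> 2 / d * norm x"
    proof (cases "x = 0")
      case False
      define r where "r = d / 2 / norm x"
      have "r > 0"
        using False \<open>d > 0\<close> by (simp add: r_def)
      have "norm (r *\<^sub>R x) = d / 2"
        using False \<open>d > 0\<close> by (simp add: r_def)
      then have "norm (f (r *\<^sub>R x)) < 1"
        using d[of "r *\<^sub>R x"] \<open>x \<in> T\<close> \<open>subspace T\<close> \<open>d > 0\<close> by (simp add: subspace_scale)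
      then have "r * norm (f x) < 1"
        using scale[OF \<open>x \<in> T\<close>, of r] \<open>r > 0\<close> by simp
      then show ?thesis
        using False \<open>d > 0\<close> by (simp add: r_def field_simps)
    qed (simp add: f0)
  qed
qed

text \<open>The bound \<open>lower\<close> stands in for a continuous inverse, so \<open>f\<close>
  can be handled without a second map.\<close>

locale linear_embedding_on =
  fixes T :: "'a::real_normed_vector set" and f :: "'a \<Rightarrow> 'b::real_normed_vector" and A B :: real
  assumes subspace: "subspace T"
    and add: "x \<in> T \<Longrightarrow> y \<in> T \<Longrightarrow> f (x + y) = f x + f y"
    and scale: "x \<in> T \<Longrightarrow> f (c *\<^sub>R x) = c *\<^sub>R f x"
    and A_pos: "A > 0" and upper: "x \<in> T \<Longrightarrow> norm (f x) \<le> A * norm x"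
    and B_pos: "B > 0" and lower: "x \<in> T \<Longrightarrow> norm x \<le> B * norm (f x)"
begin

lemma zero: "f 0 = 0"
  using scale[OF subspace_0[OF subspace], of 0] by simp

lemma diff:
  assumes "x \<in> T" "y \<in> T"
  shows "f (x - y) = f x - f y"
  using add[OF assms(1) subspace_neg[OF subspace assms(2)]] scale[OF assms(2), of "-1"] by simp

text \<open>The bound \<open>lower\<close>, applied to differences, lets \<open>f\<close> reflect
  Cauchy sequences. Both closedness of image cones and the final contradiction rest on this.\<close>

lemma Cauchy_preimage:
  assumes T: "\<And>n. a n \<in> T" and "Cauchy (\<lambda>n. f (a n))"
  shows "Cauchy a"
proof (rule CauchyI)
  fix e :: real assume "e > 0"
  then obtain M where M: "\<And>m n. m \<ge> M \<Longrightarrow> n \<ge> M \<Longrightarrow> norm (f (a m) - f (a n)) < e / B"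
    using CauchyD[OF assms(2), of "e / B"] B_pos by auto
  have "norm (a m - a n) < e" if "m \<ge> M" "n \<ge> M" for m n
  proof -
    have "norm (a m - a n) \<le> B * norm (f (a m) - f (a n))"
      using lower[of "a m - a n"] T subspace by (simp add: diff subspace_diff)
    also have "\<dots> < e"
      using M[OF that] B_pos by (simp add: field_simps)
    finally show ?thesis .
  qed
  then show "\<exists>M. \<forall>m\<ge>M. \<forall>n\<ge>M. norm (a m - a n) < e"
    by blast
qed

text \<open>A limit of image points is not known in advance to be a value of \<open>f\<close>. The
  preimages form a Cauchy sequence, and completeness of \<open>K\<close> supplies the point that
  \<open>f\<close> sends to the limit.\<close>

lemma closed_image:
  assumes "complete K" "K \<subseteq> T"
  shows "closed (f ` K)"
proof (unfold closed_sequential_limits, intro allI impI, elim conjE)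
  fix b l assume "\<forall>n. b n \<in> f ` K" and lim: "b \<longlonglongrightarrow> l"
  then obtain a where K: "\<And>n. a n \<in> K" and b: "b = (\<lambda>n. f (a n))"
    unfolding image_iff by metis
  have "Cauchy a"
    using Cauchy_preimage[of a] K \<open>K \<subseteq> T\<close> lim b LIMSEQ_imp_Cauchy by blast
  then obtain x where "x \<in> K" and x: "a \<longlonglongrightarrow> x"
    using completeE[OF \<open>complete K\<close>] K by blast
  have "norm (b n - f x) \<le> norm (a n - x) * A" for n
    using upper[of "a n - x"] K[of n] \<open>x \<in> K\<close> \<open>K \<subseteq> T\<close> subspace
    by (simp add: b diff[symmetric] subspace_diff subset_iff mult.commute)
  then have "b \<longlonglongrightarrow> f x"
    using x by (intro LIM_zero_cancel[OF tendsto_0_le[OF LIM_zero[OF x], of _ A]]) auto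
  then have "l = f x"
    using lim LIMSEQ_unique by blast
  then show "l \<in> f ` K"
    using \<open>x \<in> K\<close> by blast
qed

lemma order_cone_image:
  assumes "order_cone K" "K \<subseteq> T"
  shows "order_cone (f ` K)"
  unfolding order_cone_def cone_def
proof (intro conjI ballI allI impI)
  show "f ` K \<noteq> {}"
    using assms by (simp add: order_cone_def)
next
  fix y and c :: real assume "y \<in> f ` K" "0 \<le> c"
  then obtain a where "a \<in> K" "y = f a"
    by blast
  then have "c *\<^sub>R y = f (c *\<^sub>R a)" "c *\<^sub>R a \<in> K"
    using assms scale \<open>0 \<le> c\<close> by (auto simp: order_cone_def cone_def)
  then show "c *\<^sub>R y \<in> f ` K"
    by blast
next
  fix y z assume "y \<in> f ` K" "z \<in> f ` K"
  then obtain a b where "a \<in> K" "b \<in> K" "y = f a" "z = f b"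
    by blast
  then have "y + z = f (a + b)" "a + b \<in> K"
    using assms add[of a b] by (auto simp: order_cone_def subset_iff)
  then show "y + z \<in> f ` K"
    by blast
qed

text \<open>An order interval in the image pulls back to one in \<open>T\<close>: with
  \<open>y = f a\<close> and \<open>z - y = f b\<close>, the element \<open>a\<close> lies below
  \<open>a + b\<close>. Passing there and back multiplies the constant \<open>C\<close> by
  \<open>A\<close> and \<open>B\<close>.\<close>

lemma normal_cone_image:
  assumes K: "normal_cone K" "K \<subseteq> T"
  shows "normal_cone (f ` K)"
proof -
  obtain C where "C > 0" and C: "\<And>x y. cone_le K 0 x \<Longrightarrow> cone_le K x y \<Longrightarrow> norm x \<le> C * norm y"
    using K(1) unfolding normal_cone_def by blast
  have oc: "order_cone K"
    using K(1) by (simp add: normal_cone_def)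
  have "norm y \<le> A * C * B * norm z" if yz: "cone_le (f ` K) 0 y" "cone_le (f ` K) y z" for y z
  proof -
    obtain a b where ab: "a \<in> K" "b \<in> K" "y = f a" "z - y = f b"
      using yz unfolding cone_le_def diff_zero by blast
    then have T: "a \<in> T" "b \<in> T" "a + b \<in> T"
      using K(2) subspace subspace_add by blast+
    have z: "z = f (a + b)"
      using ab T by (simp add: add algebra_simps)
    have "norm y \<le> A * norm a"
      using ab T upper by simp
    also have "\<dots> \<le> A * (C * norm (a + b))"
      using C[of a "a + b"] ab A_pos by (simp add: cone_le_def)
    also have "\<dots> \<le> A * (C * (B * norm z))"
      using lower[OF T(3)] z A_pos \<open>C > 0\<close> by simp
    finally show ?thesis
      by (simp add: mult.assoc)
  qed
  moreover have "A * C * B > 0"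
    using A_pos B_pos \<open>C > 0\<close> by simp
  ultimately show ?thesis
    using order_cone_image[OF oc K(2)] unfolding normal_cone_def by blast
qed

lemma cone_convex_image:
  assumes "cone_convex K G" and G: "\<And>x. G x \<in> T"
  shows "cone_convex (f ` K) (\<lambda>x. f (G x))"
  unfolding cone_convex_def
proof (intro allI ballI)
  fix x y and l :: real assume "l \<in> {0..1}"
  then have "l *\<^sub>R G x + (1 - l) *\<^sub>R G y - G (l *\<^sub>R x + (1 - l) *\<^sub>R y) \<in> K"
    using assms(1) by (simp add: cone_convex_def)
  moreover have "l *\<^sub>R f (G x) + (1 - l) *\<^sub>R f (G y) - f (G (l *\<^sub>R x + (1 - l) *\<^sub>R y)) =
      f (l *\<^sub>R G x + (1 - l) *\<^sub>R G y - G (l *\<^sub>R x + (1 - l) *\<^sub>R y))"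
    using G subspace by (simp add: add diff scale subspace_add subspace_scale)
  ultimately show "l *\<^sub>R f (G x) + (1 - l) *\<^sub>R f (G y) - f (G (l *\<^sub>R x + (1 - l) *\<^sub>R y)) \<in> f ` K"
    by simp
qed

end

text \<open>Continuity of \<open>f\<close> yields the upper bound, and continuity of its inverse
  \<open>g\<close> the lower one.\<close>

lemma linearly_homeomorphic_imp_linear_embedding_on:
  fixes T :: "'a::real_normed_vector set" and S :: "'b::real_normed_vector set"
  assumes "linearly_homeomorphic T S" "subspace T" "subspace S"
  obtains f :: "'a \<Rightarrow> 'b" and A B where "linear_embedding_on T f A B"
proof -
  obtain f g where hom: "homeomorphism T S f g"
    and add: "\<And>x y. x \<in> T \<Longrightarrow> y \<in> T \<Longrightarrow> f (x + y) = f x + f y"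
    and scale: "\<And>c x. x \<in> T \<Longrightarrow> f (c *\<^sub>R x) = c *\<^sub>R f x"
    using assms(1) unfolding linearly_homeomorphic_def by blast
  have gf: "\<And>x. x \<in> T \<Longrightarrow> g (f x) = x" and fg: "\<And>y. y \<in> S \<Longrightarrow> f (g y) = y"
    and f: "\<And>x. x \<in> T \<Longrightarrow> f x \<in> S" and g: "\<And>y. y \<in> S \<Longrightarrow> g y \<in> T"
    and cont: "continuous_on T f" "continuous_on S g"
    using hom unfolding homeomorphism_def by blast+
  \<comment> \<open>Homogeneity of \<open>g\<close> is inherited from \<open>f\<close>:
    \<open>c *\<^sub>R y\<close> is the image under \<open>f\<close> of
    \<open>c *\<^sub>R g y\<close>.\<close>
  have "g (c *\<^sub>R y) = c *\<^sub>R g y" if "y \<in> S" for c y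
    using that gf[of "c *\<^sub>R g y"] by (simp add: scale fg g subspace_scale[OF assms(2)])
  then obtain B where B: "B > 0" "\<And>y. y \<in> S \<Longrightarrow> norm (g y) \<le> B * norm y"
    using homogeneous_continuous_on_subspace_bounded[OF assms(3) cont(2)] by blast
  obtain A where A: "A > 0" "\<And>x. x \<in> T \<Longrightarrow> norm (f x) \<le> A * norm x"
    using homogeneous_continuous_on_subspace_bounded[OF assms(2) cont(1) scale] by blast
  have "norm x \<le> B * norm (f x)" if "x \<in> T" for x
    using B(2)[OF f[OF that]] gf[OF that] by simp
  with A B add scale assms(2) have "linear_embedding_on T f A B"
    by unfold_locales auto
  then show thesis
    by (rule that)
qed

text \<open>The library instance \<open>bcontfun :: (metric_space, complete_space) complete_space\<close> does not
  apply to \<open>nat \<Rightarrow>\<^sub>C real\<close>, as \<open>nat\<close> is no instance of \<open>metric_space\<close>.\<close>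

lemma complete_UNIV_bcontfun:
  "complete (UNIV :: ('a::topological_space \<Rightarrow>\<^sub>C 'b::complete_space) set)"
proof (rule completeI)
  fix a :: "nat \<Rightarrow> 'a \<Rightarrow>\<^sub>C 'b"
  assume "Cauchy a"
  have "uniformly_Cauchy_on UNIV (\<lambda>n. apply_bcontfun (a n))"
  proof (rule uniformly_Cauchy_onI)
    fix e :: real assume "e > 0"
    then obtain M where "\<And>m n. m \<ge> M \<Longrightarrow> n \<ge> M \<Longrightarrow> dist (a m) (a n) < e"
      using metric_CauchyD[OF \<open>Cauchy a\<close>] by blast
    then show "\<exists>M. \<forall>x\<in>UNIV. \<forall>m\<ge>M. \<forall>n\<ge>M. dist (a m x) (a n x) < e"
      using dist_fun_lt_imp_dist_val_lt by blast
  qed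
  then obtain l where "uniform_limit UNIV (\<lambda>n. apply_bcontfun (a n)) l sequentially"
    using Cauchy_uniformly_convergent unfolding uniformly_convergent_on_def by blast
  then obtain l' where "a \<longlonglongrightarrow> l'"
    by (rule uniform_limit_bcontfunE) simp
  then show "\<exists>l\<in>UNIV. a \<longlonglongrightarrow> l"
    by blast
qed

section \<open>Null sequences as a closed subspace\<close>

lemma null_sequence_in_bcontfun:
  fixes s :: "nat \<Rightarrow> real"
  assumes "s \<longlonglongrightarrow> 0"
  shows "s \<in> bcontfun"
  using convergent_imp_bounded[OF assms] by (simp add: bcontfun_def)

lemma subspace_c0: "subspace c0"
  unfolding c0_def
proof (rule subspaceI)
  show "0 \<in> {f. apply_bcontfun f \<longlonglongrightarrow> (0::real)}"
    by simp
next
  fix a b :: "nat \<Rightarrow>\<^sub>C real"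
  assume "a \<in> {f. apply_bcontfun f \<longlonglongrightarrow> 0}" "b \<in> {f. apply_bcontfun f \<longlonglongrightarrow> 0}"
  then show "a + b \<in> {f. apply_bcontfun f \<longlonglongrightarrow> 0}"
    using tendsto_add[of a 0 sequentially b 0] by simp
next
  fix c and a :: "nat \<Rightarrow>\<^sub>C real"
  assume "a \<in> {f. apply_bcontfun f \<longlonglongrightarrow> 0}"
  then show "c *\<^sub>R a \<in> {f. apply_bcontfun f \<longlonglongrightarrow> 0}"
    using tendsto_mult_right_zero[of a sequentially c] by simp
qed

lemma closed_c0: "closed c0"
proof (unfold closed_sequential_limits, intro allI impI, elim conjE)
  fix a :: "nat \<Rightarrow> nat \<Rightarrow>\<^sub>C real" and l
  assume a: "\<forall>n. a n \<in> c0" and lim: "a \<longlonglongrightarrow> l"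
  have "apply_bcontfun l \<longlonglongrightarrow> 0"
  proof (rule LIMSEQ_I)
    fix e :: real assume "e > 0"
    then obtain k where k: "dist (a k) l < e / 2"
      using metric_LIMSEQ_D[OF lim, of "e / 2"] by auto
    obtain N where N: "\<And>n. n \<ge> N \<Longrightarrow> norm (a k n) < e / 2"
      using LIMSEQ_D[of "a k" 0 "e / 2"] a \<open>e > 0\<close> by (auto simp: c0_def)
    have "norm (l n - 0) < e" if "n \<ge> N" for n
      using N[OF that] dist_bounded[of "a k" n l] k by (simp add: dist_real_def)
    then show "\<exists>N. \<forall>n\<ge>N. norm (l n - 0) < e"
      by blast
  qed
  then show "l \<in> c0"
    by (simp add: c0_def)
qed

section \<open>The cone of nonnegative convergent sequences\<close>

definition convergent_cone :: "(nat \<Rightarrow>\<^sub>C real) set" where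
  "convergent_cone = {a \<in> c0. \<forall>n. 0 \<le> a 0 + a (Suc n)}"

lemma convergent_cone_subset_c0: "convergent_cone \<subseteq> c0"
  by (auto simp: convergent_cone_def)

text \<open>\<open>a 0\<close> is the limit of the nonnegative decoded entries
  \<open>a 0 + a (Suc n)\<close>.\<close>

lemma convergent_cone_nonneg_0:
  assumes "a \<in> convergent_cone"
  shows "0 \<le> a 0"
proof (rule LIMSEQ_le_const)
  have "(\<lambda>n. a (Suc n)) \<longlonglongrightarrow> 0"
    using assms LIMSEQ_Suc by (auto simp: convergent_cone_def c0_def)
  then show "(\<lambda>n. a 0 + a (Suc n)) \<longlonglongrightarrow> a 0"
    using tendsto_add[OF tendsto_const] by fastforce
  show "\<exists>N. \<forall>n\<ge>N. 0 \<le> a 0 + a (Suc n)"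
    using assms by (simp add: convergent_cone_def)
qed

lemma order_cone_convergent_cone: "order_cone convergent_cone"
  unfolding order_cone_def cone_def
proof (intro conjI ballI allI impI)
  show "convergent_cone \<noteq> {}"
    using subspace_0[OF subspace_c0] by (auto simp: convergent_cone_def)
next
  fix a and c :: real assume "a \<in> convergent_cone" "0 \<le> c"
  then have "c *\<^sub>R a \<in> c0" and "0 \<le> c * (a 0 + a (Suc n))" for n
    using subspace_scale[OF subspace_c0] by (simp_all add: convergent_cone_def)
  then show "c *\<^sub>R a \<in> convergent_cone"
    by (simp add: convergent_cone_def distrib_left)
next
  fix a b assume ab: "a \<in> convergent_cone" "b \<in> convergent_cone"
  then have "a + b \<in> c0"
    by (simp add: convergent_cone_def subspace_add[OF subspace_c0])
  moreover have "0 \<le> (a + b) 0 + (a + b) (Suc n)" for n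
  proof -
    have "0 \<le> a 0 + a (Suc n)" "0 \<le> b 0 + b (Suc n)"
      using ab by (simp_all add: convergent_cone_def)
    then show ?thesis
      by simp
  qed
  ultimately show "a + b \<in> convergent_cone"
    by (simp add: convergent_cone_def)
qed

lemma closed_convergent_cone: "closed convergent_cone"
proof (unfold closed_sequential_limits, intro allI impI, elim conjE)
  fix a :: "nat \<Rightarrow> nat \<Rightarrow>\<^sub>C real" and l
  assume a: "\<forall>n. a n \<in> convergent_cone" and lim: "a \<longlonglongrightarrow> l"
  have eval: "(\<lambda>k. a k n) \<longlonglongrightarrow> l n" for n
    by (rule tendsto_uniform_limitI[OF tendsto_bcontfun_uniform_limit[OF lim]]) simp
  have "l \<in> c0"
    using closed_sequentially[OF closed_c0 _ lim] a convergent_cone_subset_c0 by blast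
  moreover have "0 \<le> l 0 + l (Suc n)" for n
    using a by (intro LIMSEQ_le_const[OF tendsto_add[OF eval eval]]) (simp add: convergent_cone_def)
  ultimately show "l \<in> convergent_cone"
    by (simp add: convergent_cone_def)
qed

lemma complete_convergent_cone: "complete convergent_cone"
  using complete_Int_closed[OF complete_UNIV_bcontfun closed_convergent_cone] by simp

text \<open>The limit entries satisfy \<open>0 \<le> a 0 \<le> b 0\<close>, and the decoded entries
  of \<open>a\<close> lie between \<open>0\<close> and those of \<open>b\<close>, hence below
  \<open>2 * norm b\<close>. Subtracting \<open>a 0\<close> to return to the coded entries costs at
  most one more \<open>norm b\<close>, whence the constant \<open>3\<close>.\<close>

lemma normal_cone_convergent_cone: "normal_cone convergent_cone"
proof -
  have "norm a \<le> 3 * norm b"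
    if "cone_le convergent_cone 0 a" "cone_le convergent_cone a b" for a b
  proof (rule norm_bound)
    have ab: "a \<in> convergent_cone" "b - a \<in> convergent_cone"
      using that by (simp_all add: cone_le_def)
    have b: "\<bar>b n\<bar> \<le> norm b" for n
      using norm_bounded[of b n] by simp
    have a0: "0 \<le> a 0" "a 0 \<le> b 0"
      using ab[THEN convergent_cone_nonneg_0] by simp_all
    fix n
    show "norm (a n) \<le> 3 * norm b"
    proof (cases n)
      case 0
      then show ?thesis
        using a0 b[of 0] by simp
    next
      case (Suc k)
      have "0 \<le> a 0 + a (Suc k)" "0 \<le> (b 0 - a 0) + (b (Suc k) - a (Suc k))"
        using ab by (simp_all add: convergent_cone_def)
      then show ?thesis
        using a0 b[of 0] b[of "Suc k"] Suc by simp
    qed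
  qed
  then show ?thesis
    using order_cone_convergent_cone unfolding normal_cone_def
    by (metis zero_less_numeral)
qed

lemma convex_order_cone: "order_cone K \<Longrightarrow> convex K"
  by (simp add: order_cone_def convex_def cone_def)

section \<open>A convex curve without a right derivative at zero\<close>

text \<open>Index \<open>0\<close> carries the limit of the ramps and index \<open>Suc k\<close> the
  deviation from it of the ramp with kink at \<open>1 / real (Suc k)\<close>. The kinks decrease to
  \<open>0\<close>, so each single ramp vanishes near \<open>0\<close> while their limit has its
  kink there.\<close>

definition hinge_sequence :: "real \<Rightarrow> nat \<Rightarrow> real" where
  "hinge_sequence t n =
     (case n of 0 \<Rightarrow> max 0 t | Suc k \<Rightarrow> max 0 (t - 1 / real (Suc k)) - max 0 t)"

definition hinge :: "real \<Rightarrow> nat \<Rightarrow>\<^sub>C real" where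
  "hinge t = Bcontfun (hinge_sequence t)"

lemma hinge_sequence_tendsto_0: "hinge_sequence t \<longlonglongrightarrow> 0"
proof (rule LIMSEQ_imp_Suc)
  have "(\<lambda>k. max 0 (t - 1 / real (Suc k)) - max 0 t) \<longlonglongrightarrow> max 0 (t - 0) - max 0 t"
    by (intro tendsto_intros LIMSEQ_Suc[OF lim_1_over_n])
  then show "(\<lambda>k. hinge_sequence t (Suc k)) \<longlonglongrightarrow> 0"
    by (simp add: hinge_sequence_def)
qed

lemma apply_hinge: "apply_bcontfun (hinge t) = hinge_sequence t"
  unfolding hinge_def
  by (rule Bcontfun_inverse) (rule null_sequence_in_bcontfun[OF hinge_sequence_tendsto_0])

lemma hinge_in_c0: "hinge t \<in> c0"
  by (simp add: c0_def apply_hinge hinge_sequence_tendsto_0)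

lemma hinge_0: "hinge 0 = 0"
  by (rule bcontfun_eqI) (simp add: apply_hinge hinge_sequence_def split: nat.split)

lemma max_0_convex:
  fixes l u v :: real
  assumes "l \<in> {0..1}"
  shows "max 0 (l * u + (1 - l) * v) \<le> l * max 0 u + (1 - l) * max 0 v"
proof -
  have "l * u \<le> l * max 0 u" "(1 - l) * v \<le> (1 - l) * max 0 v"
    "0 \<le> l * max 0 u" "0 \<le> (1 - l) * max 0 v"
    using assms by (auto intro: mult_left_mono)
  then show ?thesis
    by linarith
qed

text \<open>Decoding an entry cancels the \<open>max 0 t\<close> terms, so membership in the cone
  reduces to convexity of one shifted ramp.\<close>

lemma cone_convex_hinge: "cone_convex convergent_cone hinge"
  unfolding cone_convex_def
proof (intro allI ballI)
  fix s t l :: real assume l: "l \<in> {0..1}"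
  let ?a = "l *\<^sub>R hinge s + (1 - l) *\<^sub>R hinge t - hinge (l *\<^sub>R s + (1 - l) *\<^sub>R t)"
  have "0 \<le> ?a 0 + ?a (Suc n)" for n
  proof -
    define d where "d = 1 / real (Suc n)"
    have "?a 0 + ?a (Suc n) =
        l * max 0 (s - d) + (1 - l) * max 0 (t - d) - max 0 (l * s + (1 - l) * t - d)"
      by (simp add: apply_hinge hinge_sequence_def d_def algebra_simps)
    moreover have "l * s + (1 - l) * t - d = l * (s - d) + (1 - l) * (t - d)"
      by (simp add: algebra_simps)
    ultimately show ?thesis
      using max_0_convex[OF l, of "s - d" "t - d"] by simp
  qed
  then show "?a \<in> convergent_cone"
    by (simp add: convergent_cone_def subspace_c0 subspace_add subspace_diff subspace_scale
        hinge_in_c0)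
qed

text \<open>For a ramp with kink at \<open>d\<close>, the coded entry of the quotient is
  \<open>- 1 / 2\<close> at \<open>t = 2 * d\<close> and \<open>- 1\<close> at \<open>t = d\<close>.
  Such pairs occur arbitrarily close to \<open>0\<close>.\<close>

lemma hinge_quotients_not_Cauchy: "\<not> Cauchy (\<lambda>k. hinge (1 / real (Suc k)) /\<^sub>R (1 / real (Suc k)))"
  (is "\<not> Cauchy ?Q")
proof
  assume "Cauchy ?Q"
  then obtain M where M: "\<And>m n. m \<ge> M \<Longrightarrow> n \<ge> M \<Longrightarrow> norm (?Q m - ?Q n) < 1 / 2"
    using CauchyD[of ?Q "1 / 2"] by auto
  \<comment> \<open>This makes \<open>Suc N\<close> twice \<open>Suc M\<close>: the kink of ramp
    \<open>N\<close> is the parameter of \<open>?Q N\<close> and half the parameter of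
    \<open>?Q M\<close>.\<close>
  define N where "N = 2 * M + 1"
  have N: "1 / real (Suc N) = 1 / real (Suc M) / 2"
    by (simp add: N_def field_simps)
  have "?Q M (Suc N) = - 1 / 2"
    unfolding apply_hinge hinge_sequence_def scaleR_bcontfun.rep_eq nat.case N
    by (simp add: max_def divide_simps)
  moreover have "?Q N (Suc N) = - 1"
    by (simp add: apply_hinge hinge_sequence_def)
  ultimately have "(?Q M - ?Q N) (Suc N) = 1 / 2"
    by simp
  then have "norm (?Q M - ?Q N) \<ge> 1 / 2"
    using norm_bounded[of "?Q M - ?Q N" "Suc N"] by simp
  then show False
    using M[of M N] by (simp add: N_def)
qed

section \<open>Transfer to the given spaces\<close>

text \<open>The domain is a bare vector space, so an algebraic extension from the independent set
  \<open>{h}\<close> is the right notion.\<close>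

lemma exists_linear_functional:
  fixes h :: "'x::real_vector"
  assumes "h \<noteq> 0"
  obtains \<phi> :: "'x \<Rightarrow> real" where "linear \<phi>" "\<phi> h = 1"
  using linear_independent_extend[of "{h}" "\<lambda>_. 1::real"] assms by auto

lemma cone_convex_comp_linear:
  assumes "cone_convex K G" "linear \<phi>"
  shows "cone_convex K (\<lambda>x. G (\<phi> x))"
  using assms(1) unfolding cone_convex_def
  by (simp add: linear_add[OF assms(2)] linear_cmul[OF assms(2)])

theorem theorem5p1:
  assumes X_nontrivial: "\<exists>x::'x::real_vector. x \<noteq> 0"
    and dir_diff: "\<And>(K :: 'y::banach set) (F :: 'x \<Rightarrow> 'y) h.
      closed K \<Longrightarrow> convex K \<Longrightarrow> normal_cone K \<Longrightarrow> cone_convex K F \<Longrightarrow> h \<noteq> 0 \<Longrightarrow>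
      dir_differentiable F 0 h"
  shows "\<not> (\<exists>S :: 'y set. subspace S \<and> linearly_homeomorphic c0 S)"
proof
  assume "\<exists>S :: 'y set. subspace S \<and> linearly_homeomorphic c0 S"
  then obtain f :: "(nat \<Rightarrow>\<^sub>C real) \<Rightarrow> 'y" and A B where "linear_embedding_on c0 f A B"
    using linearly_homeomorphic_imp_linear_embedding_on subspace_c0 by metis
  then interpret linear_embedding_on c0 f A B .
  obtain h :: 'x where "h \<noteq> 0"
    using X_nontrivial by blast
  then obtain \<phi> :: "'x \<Rightarrow> real" where \<phi>: "linear \<phi>" "\<phi> h = 1"
    by (rule exists_linear_functional)
  let ?K = "f ` convergent_cone" and ?F = "\<lambda>x. f (hinge (\<phi> x))"
  have "normal_cone ?K"
    using normal_cone_convergent_cone convergent_cone_subset_c0 by (rule normal_cone_image)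
  moreover have "convex ?K"
    using calculation by (simp add: normal_cone_def convex_order_cone)
  moreover have "closed ?K"
    using complete_convergent_cone convergent_cone_subset_c0 by (rule closed_image)
  moreover have "cone_convex ?K ?F"
    using cone_convex_image[OF cone_convex_hinge hinge_in_c0] \<phi>(1) by (rule cone_convex_comp_linear)
  ultimately have "dir_differentiable ?F 0 h"
    using dir_diff \<open>h \<noteq> 0\<close> by blast
  then obtain D where "((\<lambda>t. (?F (0 + t *\<^sub>R h) - ?F 0) /\<^sub>R t) \<longlongrightarrow> D) (at_right 0)"
    unfolding dir_differentiable_def has_dir_derivative_def by blast
  \<comment> \<open>Along \<open>h\<close> the functional returns \<open>t\<close> itself, and
    \<open>hinge 0 = 0\<close>, so the quotient of \<open>?F\<close> is \<open>f\<close> applied to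
    the quotient of \<open>hinge\<close>.\<close>
  then have D: "((\<lambda>t. f (hinge t /\<^sub>R t)) \<longlongrightarrow> D) (at_right 0)"
    using \<phi> by (simp add: linear_cmul linear_0 hinge_0 zero scale hinge_in_c0)
  have "filterlim (\<lambda>k. 1 / real (Suc k)) (at_right 0) sequentially"
    by (intro tendsto_imp_filterlim_at_right LIMSEQ_Suc[OF lim_1_over_n]) simp
  with D have "(\<lambda>k. f (hinge (1 / real (Suc k)) /\<^sub>R (1 / real (Suc k)))) \<longlonglongrightarrow> D"
    by (rule filterlim_compose)
  \<comment> \<open>Pulling back the Cauchy property, rather than the limit, avoids asking whether
    \<open>D\<close> is a value of \<open>f\<close> on \<open>c0\<close>.\<close>
  then have "Cauchy (\<lambda>k. hinge (1 / real (Suc k)) /\<^sub>R (1 / real (Suc k)))"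
    using LIMSEQ_imp_Cauchy
    by (intro Cauchy_preimage subspace_scale[OF subspace_c0] hinge_in_c0)
  then show False
    using hinge_quotients_not_Cauchy by contradiction
qed

end
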